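(* There exists a Lucas semigroup that is not a local Lucas semigroup.
   Context: $\mathbb{N}=\{0,1,2,\ldots\}$. For $P,Q\in\mathbb{Z}$, the Lucas sequence $U_n=U_n(P,Q)$ is defined by $U_0=0$, $U_1=1$, $U_{n+2}=PU_{n+1}-QU_n$. For $R\in\mathbb{Q}$, $\mathcal{L}(P,Q,R)=\{n\in\mathbb{N} : U_nR\in\mathbb{Z}\}$. A Lucas semigroup is a set of the form $\mathcal{L}(P,Q,R)$ with $P,Q\in\mathbb{Z}$, $R\in\mathbb{Q}$; a local Lucas semigroup is one of the form $\mathcal{L}(P,Q,p^{-r})$ with $P,Q\in\mathbb{Z}$, $p$ prime, and $r\in\mathbb{Z}$. *)

theory Defs
  imports Complex_Main "HOL-Computational_Algebra.Primes"
begin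

fun lucas_U :: "int \<Rightarrow> int \<Rightarrow> nat \<Rightarrow> int" where
  "lucas_U P Q 0 = 0"
| "lucas_U P Q (Suc 0) = 1"
| "lucas_U P Q (Suc (Suc n)) = P * lucas_U P Q (Suc n) - Q * lucas_U P Q n"

definition lucas_set :: "int \<Rightarrow> int \<Rightarrow> rat \<Rightarrow> nat set" where
  "lucas_set P Q R = {n. of_int (lucas_U P Q n) * R \<in> \<int>}"

definition lucas_semigroup :: "nat set \<Rightarrow> bool" where
  "lucas_semigroup S \<longleftrightarrow> (\<exists>P Q R. S = lucas_set P Q R)"

(* The exponent r is an arbitrary integer, as in the definition of a local Lucas semigroup;
   for r \<le> 0 the set is all of the natural numbers. *)
definition local_lucas_semigroup :: "nat set \<Rightarrow> bool" where
  "local_lucas_semigroup S \<longleftrightarrow>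
     (\<exists>(P::int) (Q::int) (p::nat) (r::int). prime p \<and> S = lucas_set P Q (of_nat p powi (- r)))"

end

theory Submission
  imports Defs
begin

text \<open>
  The witness is \<open>\<L>(6, 3, 1/18)\<close>. The prime \<open>2\<close> divides \<open>P\<close> but not \<open>Q\<close>,
  which leaves only even indices; modulo \<open>9\<close> the common factor \<open>3\<close> of \<open>P\<close> and \<open>Q\<close> excludes the
  index \<open>2\<close> but not \<open>4\<close> and \<open>6\<close>. A local Lucas semigroup cannot mix the two behaviours: if it
  contains \<open>4\<close> and \<open>6\<close>, then for \<open>p\<close> not dividing \<open>Q\<close> it contains \<open>2\<close>, since
  \<open>(P\<^sup>2 - 2Q) U\<^sub>4 - U\<^sub>6 = Q\<^sup>2 U\<^sub>2\<close>; and for \<open>p\<close> dividing \<open>Q\<close> the condition on \<open>U\<^sub>4 = P\<^sup>3 - 2PQ\<close>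
  forces \<open>p\<close> to divide \<open>P\<close>, so that high powers of \<open>p\<close> divide all late terms, including those
  of odd index.
\<close>

lemma lucas_U_small:
  "lucas_U P Q 2 = P"
  "lucas_U P Q 4 = P ^ 3 - 2 * P * Q"
  "lucas_U P Q 6 = (P\<^sup>2 - 2 * Q) * lucas_U P Q 4 - Q\<^sup>2 * lucas_U P Q 2"
  by (simp_all add: eval_nat_numeral algebra_simps)

text \<open>Both coefficients of the recurrence supply a factor \<open>d\<close>, so the exponent
  grows by at least one every two indices.\<close>

lemma power_dvd_lucas_U:
  assumes "d dvd P" "d dvd Q"
  shows "d ^ k dvd lucas_U P Q (2 * k) \<and> d ^ k dvd lucas_U P Q (Suc (2 * k))"
proof (induction k)
  case 0
  then show ?case by simp
next
  case (Suc k)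
  have even: "d ^ Suc k dvd lucas_U P Q (Suc (Suc (2 * k)))"
    using Suc assms by (auto intro!: dvd_diff mult_dvd_mono)
  moreover have "d ^ Suc k dvd lucas_U P Q (Suc (Suc (Suc (2 * k))))"
  proof -
    have "d ^ Suc k dvd P * lucas_U P Q (Suc (Suc (2 * k)))"
      using even by (rule dvd_mult)
    moreover have "d ^ Suc k dvd Q * lucas_U P Q (Suc (2 * k))"
      using Suc assms by (auto intro: mult_dvd_mono)
    ultimately show ?thesis
      unfolding lucas_U.simps(3)[of P Q "Suc (2 * k)"] by (rule dvd_diff)
  qed
  ultimately show ?case by simp
qed

lemma lucas_set_inverse:
  assumes "b \<noteq> 0"
  shows "lucas_set P Q (inverse (of_int b)) = {n. b dvd lucas_U P Q n}"
  using assms of_int_div_of_int_in_Ints_iff[where 'a = rat]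
  by (simp add: lucas_set_def divide_inverse)

lemma lucas_set_Ints:
  assumes "R \<in> \<int>"
  shows "lucas_set P Q R = UNIV"
  using assms by (auto simp: lucas_set_def)

lemma two_or_odd_in_local_lucas_semigroup:
  assumes "local_lucas_semigroup S" "4 \<in> S" "6 \<in> S"
  shows "2 \<in> S \<or> (\<exists>n\<in>S. odd n)"
proof -
  from assms(1) obtain P Q :: int and p :: nat and r :: int
    where p: "prime p" and S: "S = lucas_set P Q (of_nat p powi (- r))"
    unfolding local_lucas_semigroup_def by blast
  show ?thesis
  proof (cases "r \<le> 0")
    case True
    then have "(of_nat p :: rat) powi (- r) \<in> \<int>"
      by (simp add: power_int_def)
    then show ?thesis
      using S lucas_set_Ints by blast
  next
    case False
    define k where "k = nat r"
    define q where "q = int p"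
    have r: "r = int k" and k: "k > 0"
      using False by (simp_all add: k_def)
    have q: "prime q"
      using p by (simp add: q_def)
    have "(of_nat p :: rat) powi (- r) = inverse (of_int (q ^ k))"
      by (simp add: r q_def power_int_minus)
    then have S: "S = {n. q ^ k dvd lucas_U P Q n}"
      using S q lucas_set_inverse[of "q ^ k"] by auto
    show ?thesis
    proof (cases "q dvd Q")
      case True
      have "q dvd lucas_U P Q 4"
        using assms(2) k S by (auto intro: dvd_trans[OF dvd_power])
      moreover have "q dvd 2 * P * Q"
        using True by simp
      \<comment> \<open>Adding back \<open>2 * P * Q\<close> leaves just
        \<open>P ^ 3\<close>.\<close>
      ultimately have "q dvd (P ^ 3 - 2 * P * Q) + 2 * P * Q"
        unfolding lucas_U_small by (rule dvd_add)
      then have "q dvd P"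
        using q prime_dvd_power by auto
      then have "Suc (2 * k) \<in> S"
        using True power_dvd_lucas_U S by blast
      then show ?thesis
        by (auto intro!: bexI[of _ "Suc (2 * k)"])
    next
      case False
      have "q ^ k dvd (P\<^sup>2 - 2 * Q) * lucas_U P Q 4 - lucas_U P Q 6"
        using assms(2,3) S by (auto intro: dvd_diff)
      then have "q ^ k dvd Q\<^sup>2 * lucas_U P Q 2"
        by (simp add: lucas_U_small(3))
      moreover have "coprime (q ^ k) (Q\<^sup>2)"
        using q False by (simp add: prime_imp_coprime)
      ultimately have "q ^ k dvd lucas_U P Q 2"
        by (simp add: coprime_dvd_mult_right_iff)
      then show ?thesis
        using S by simp
    qed
  qed
qed

text \<open>Modulo 2 the recurrence reduces to U_(n+2) = U_n.\<close>

lemma even_lucas_U_iff: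
  assumes "even P" "odd Q"
  shows "even (lucas_U P Q n) \<longleftrightarrow> even n"
  using assms by (induction P Q n rule: lucas_U.induct) auto

theorem theorem7p1:
  shows "\<exists>S. lucas_semigroup S \<and> \<not> local_lucas_semigroup S"
proof (intro exI conjI notI)
  let ?S = "{n. 18 dvd lucas_U 6 3 n}"
  show "lucas_semigroup ?S"
    unfolding lucas_semigroup_def using lucas_set_inverse[of 18 6 3] by (metis zero_neq_numeral)
  assume "local_lucas_semigroup ?S"
  \<comment> \<open>The terms at 4, 6 and 2 are 180 = 18 * 10, 5346 = 18 * 297 and 6.\<close>
  moreover have "4 \<in> ?S" "6 \<in> ?S" "2 \<notin> ?S"
    by (simp_all add: lucas_U_small)
  moreover have "even n" if "n \<in> ?S" for n
  proof -
    have "2 dvd lucas_U 6 3 n"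
      using that by (auto intro: dvd_trans[of 2 18])
    then show ?thesis
      by (simp add: even_lucas_U_iff)
  qed
  ultimately show False
    using two_or_odd_in_local_lucas_semigroup by blast
qed

end
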